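(* Let $E,A\in\mathbb{R}^{n\times n}$ be such that $\lambda E+A$ is non-singular for some $\lambda\in\mathbb{R}$, and let $f:I\to\mathbb{R}^n$ be sufficiently smooth on an open interval $I\subseteq\mathbb{R}$. Let $k$ be the number of steps of the deflation algorithm applied to the DAE $E\dot x=Ax+f$. Then the coordinates of the solution satisfy $$E_k\dot x^{k}=A_kx^k+f_k,$$ where $E_k$ is invertible or equal to zero, and $$x^j_2=-N_j^{-1}M_jx^j_1-N_j^{-1}f_{j,\,r_j+1:r_{j-1}},\qquad 0\le j\le k-1,$$ where $f_{j,\,r_j+1:r_{j-1}}$ denotes the vector of the coordinates $r_j+1$ to $r_{j-1}$ of the vector $f_j$.
   Context: Deflation step. Let $(E,A)$ be a regular pencil of size $n\times n$ (i.e. $\lambda E+A$ is non-singular for some $\lambda\in\mathbb{R}$) with $\operatorname{rank}E=r$, and $f$ a sufficiently smooth vector function. There exist (not uniquely) an invertible matrix $U$ and a permutation matrix $P$ such that $$U^{-1}EP=\begin{pmatrix} S & T \\ 0 & 0 \end{pmatrix},\qquad U^{-1}AP=\begin{pmatrix} K & L \\ M & N \end{pmatrix},$$ with $S,K\in\mathbb{R}^{r\times r}$, $T,L\in\mathbb{R}^{r\times(n-r)}$, $M\in\mathbb{R}^{(n-r)\times r}$ and $N\in\mathbb{R}^{(n-r)\times(n-r)}$ non-singular. Write $U^{-1}f=(g,h)^T$ with $g$ of size $r$ and $h$ of size $n-r$, and $P^{-1}x=(u,v)^T$ with $u$ of size $r$. The deflated DAE is $E_1\dot x^1=A_1x^1+f_1$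 with $$E_1=S-TN^{-1}M,\quad A_1=K-LN^{-1}M,\quad f_1=TN^{-1}\dot h-LN^{-1}h+g,\quad x^1=u,$$ and the algebraic constraint associated to this deflation is $Mu+Nv+h=0$. The pencil $(E_1,A_1)$ is again regular. Deflation algorithm. Start with $E_0=E$, $A_0=A$, $f_0=f$, $x^0=x$, $r_{-1}=n$. At step $j+1$ ($j\ge0$), if $E_j$ is singular and $E_j\ne0$: let $r_j$ be the rank of $E_j$ (the matrix $E_j$ has size $r_{j-1}\times r_{j-1}$); compute $(E_{j+1},A_{j+1},f_{j+1})$ from $(E_j,A_j,f_j)$ by the formulas of the deflation step, denoting by $P_j,M_j,N_j$ the matrices $P,M,N$ used in it; put $(x_1^j,x_2^j)^T:=P_j^{-1}x^j$ with $x_1^j$ of size $r_j$; record the algebraic constraint $0=M_jx_1^j+N_jx_2^j+f_{j,\,r_j+1:r_{j-1}}$, where $f_{j,\,r_j+1:r_{j-1}}$ means the coordinates $r_j+1$ to $r_{j-1}$ of the vector $f_j$; and let $x^{j+1}:=x_1^j$. Otherwise stop.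
   Formalization: The coordinates r_j+1 to r_{j-1} are taken of U_j^{-1}f_j (the block h of the deflation step) rather than of f_j itself; with f_j itself the formula fails, e.g. for E = diag(0,1), A = I, U = P = the swap, where x_2^0 = -f_1 and not -f_2. *)

theory Defs
  imports "HOL-Analysis.Derivative" "Jordan_Normal_Form.DL_Rank"
    "Jordan_Normal_Form.Gauss_Jordan_Elimination"
begin

unbundle no vec_syntax

text \<open>
  The sizes of the matrices shrink along the algorithm, so matrices and vectors are those of
  \<^theory>\<open>Jordan_Normal_Form.Matrix\<close>, with explicit dimensions. Those vector types carry no norm;
  differentiation is therefore componentwise.
\<close>

abbreviation minv :: "real mat \<Rightarrow> real mat" where
  "minv B \<equiv> the (mat_inverse B)"

definition vderiv :: "(real \<Rightarrow> real vec) \<Rightarrow> real \<Rightarrow> real vec" where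
  "vderiv F t = vec (dim_vec (F t)) (\<lambda>i. deriv (\<lambda>s. F s $ i) t)"

text \<open>
  Only used for open \<open>I\<close>, where the values of the iterated \<^const>\<open>deriv\<close> on \<open>I\<close> depend only on \<open>F\<close> on
  \<open>I\<close>. Continuity of the highest derivative is not required.
\<close>

definition times_differentiable_on :: "nat \<Rightarrow> nat \<Rightarrow> real set \<Rightarrow> (real \<Rightarrow> real vec) \<Rightarrow> bool" where
  "times_differentiable_on k n I F \<longleftrightarrow>
     (\<forall>i<n. \<forall>m<k. \<forall>t\<in>I. (deriv ^^ m) (\<lambda>s. F s $ i) differentiable at t)"

definition regular_pencil :: "real mat \<Rightarrow> real mat \<Rightarrow> bool" where
  "regular_pencil E A \<longleftrightarrow> (\<exists>c. invertible_mat (c \<cdot>\<^sub>m E + A))"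

definition is_permutation_mat :: "nat \<Rightarrow> real mat \<Rightarrow> bool" where
  "is_permutation_mat n P \<longleftrightarrow>
     (\<exists>p. p permutes {..<n} \<and> P = mat n n (\<lambda>(i, j). if i = p j then 1 else 0))"

text \<open>The system \<open>E x' = A x + f\<close> with \<open>E\<close>, \<open>A\<close> square of size \<open>dsize\<close>.\<close>

record dae =
  dsize :: nat
  dE :: "real mat"
  dA :: "real mat"
  df :: "real \<Rightarrow> real vec"

definition solves_on :: "real set \<Rightarrow> dae \<Rightarrow> (real \<Rightarrow> real vec) \<Rightarrow> bool" where
  "solves_on I D x \<longleftrightarrow>
     (\<forall>t\<in>I. x t \<in> carrier_vec (dsize D) \<and>
        (\<forall>i<dsize D. (\<lambda>s. x s $ i) differentiable at t) \<and>
        dE D *\<^sub>v vderiv x t = dA D *\<^sub>v x t + df D t)"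

abbreviation drank :: "dae \<Rightarrow> nat" where
  "drank D \<equiv> vec_space.rank (dsize D) (dE D)"

text \<open>The matrices chosen in one deflation step; they are not unique.\<close>

record deflation =
  mU :: "real mat"
  mP :: "real mat"
  mS :: "real mat"
  mT :: "real mat"
  mK :: "real mat"
  mL :: "real mat"
  mM :: "real mat"
  mN :: "real mat"

definition is_deflation :: "dae \<Rightarrow> deflation \<Rightarrow> bool" where
  "is_deflation D d \<longleftrightarrow> (let n = dsize D; r = drank D in
     mU d \<in> carrier_mat n n \<and> invertible_mat (mU d) \<and> is_permutation_mat n (mP d) \<and>
     mS d \<in> carrier_mat r r \<and> mT d \<in> carrier_mat r (n - r) \<and>
     mK d \<in> carrier_mat r r \<and> mL d \<in> carrier_mat r (n - r) \<and>
     mM d \<in> carrier_mat (n - r) r \<and> mN d \<in> carrier_mat (n - r) (n - r) \<and>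
     invertible_mat (mN d) \<and>
     minv (mU d) * dE D * mP d =
       four_block_mat (mS d) (mT d) (0\<^sub>m (n - r) r) (0\<^sub>m (n - r) (n - r)) \<and>
     minv (mU d) * dA D * mP d = four_block_mat (mK d) (mL d) (mM d) (mN d))"

text \<open>
  \<open>U\<^sup>-\<^sup>1 f = (g, h)\<close>. The coordinates \<open>r\<^sub>j + 1\<close> to \<open>r\<^bsub>j-1\<^esub>\<close> of \<open>f\<^sub>j\<close> that enter the algebraic constraint
  \<open>M u + N v + h = 0\<close> are the coordinates after \<open>f\<^sub>j\<close> has been multiplied by \<open>U\<^sub>j\<^sup>-\<^sup>1\<close>, that is, \<open>h\<close>.
\<close>

definition f_upper :: "dae \<Rightarrow> deflation \<Rightarrow> real \<Rightarrow> real vec" where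
  "f_upper D d t = vec_first (minv (mU d) *\<^sub>v df D t) (drank D)"

definition f_lower :: "dae \<Rightarrow> deflation \<Rightarrow> real \<Rightarrow> real vec" where
  "f_lower D d t = vec_last (minv (mU d) *\<^sub>v df D t) (dsize D - drank D)"

definition deflate :: "dae \<Rightarrow> deflation \<Rightarrow> dae" where
  "deflate D d = \<lparr>
     dsize = drank D,
     dE = mS d - mT d * minv (mN d) * mM d,
     dA = mK d - mL d * minv (mN d) * mM d,
     df = (\<lambda>t. (mT d * minv (mN d)) *\<^sub>v vderiv (f_lower D d) t
               - (mL d * minv (mN d)) *\<^sub>v f_lower D d t + f_upper D d t) \<rparr>"

definition x_upper :: "dae \<Rightarrow> deflation \<Rightarrow> (real \<Rightarrow> real vec) \<Rightarrow> real \<Rightarrow> real vec" where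
  "x_upper D d x t = vec_first (minv (mP d) *\<^sub>v x t) (drank D)"

definition x_lower :: "dae \<Rightarrow> deflation \<Rightarrow> (real \<Rightarrow> real vec) \<Rightarrow> real \<Rightarrow> real vec" where
  "x_lower D d x t = vec_last (minv (mP d) *\<^sub>v x t) (dsize D - drank D)"

text \<open>
  Given the choices \<open>ds\<close>, the system \<open>(E\<^sub>j, A\<^sub>j, f\<^sub>j)\<close> is \<open>dae_seq D ds j\<close> and \<open>x\<^sup>j\<close> is \<open>x_seq D ds x j\<close>.
  The size \<open>r\<^bsub>j-1\<^esub>\<close> of \<open>E\<^sub>j\<close> is \<open>dsize (dae_seq D ds j)\<close>.
\<close>

primrec dae_seq :: "dae \<Rightarrow> (nat \<Rightarrow> deflation) \<Rightarrow> nat \<Rightarrow> dae" where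
  "dae_seq D ds 0 = D"
| "dae_seq D ds (Suc j) = deflate (dae_seq D ds j) (ds j)"

primrec x_seq ::
  "dae \<Rightarrow> (nat \<Rightarrow> deflation) \<Rightarrow> (real \<Rightarrow> real vec) \<Rightarrow> nat \<Rightarrow> real \<Rightarrow> real vec" where
  "x_seq D ds x 0 = x"
| "x_seq D ds x (Suc j) = x_upper (dae_seq D ds j) (ds j) (x_seq D ds x j)"

definition continues :: "dae \<Rightarrow> bool" where
  "continues D \<longleftrightarrow> \<not> invertible_mat (dE D) \<and> dE D \<noteq> 0\<^sub>m (dsize D) (dsize D)"

text \<open>The choices \<open>ds j\<close> with \<open>j < k\<close> are the first \<open>k\<close> steps of the algorithm.\<close>

definition deflation_run :: "dae \<Rightarrow> (nat \<Rightarrow> deflation) \<Rightarrow> nat \<Rightarrow> bool" where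
  "deflation_run D ds k \<longleftrightarrow>
     (\<forall>j<k. continues (dae_seq D ds j) \<and> is_deflation (dae_seq D ds j) (ds j))"

definition complete_deflation_run :: "dae \<Rightarrow> (nat \<Rightarrow> deflation) \<Rightarrow> nat \<Rightarrow> bool" where
  "complete_deflation_run D ds k \<longleftrightarrow> deflation_run D ds k \<and> \<not> continues (dae_seq D ds k)"

end

theory Submission
  imports Defs
begin

text \<open>
  A step exists for a regular pencil: choosing \<open>U\<close> so that the last \<open>n - r\<close> rows of \<open>U\<^sup>-\<^sup>1 E\<close> vanish, the
  last rows of the invertible matrix \<open>U\<^sup>-\<^sup>1 (c E + A)\<close> coincide with those of \<open>U\<^sup>-\<^sup>1 A\<close>, so some \<open>n - r\<close>
  of their columns form an invertible matrix \<open>N\<close>. The deflated pencil is the Schur complement of \<open>N\<close>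
  in the transformed pencil, hence regular again, and its size \<open>r\<close> is smaller because \<open>E\<close> is
  singular. Along a solution the constraint reads \<open>h = - (M u + N v)\<close>, so \<open>h\<close> is differentiable, and
  eliminating \<open>v\<close> and \<open>v'\<close> from the first \<open>r\<close> equations gives the deflated system.
\<close>

section \<open>Invertibility and permutation matrices\<close>

lemma invertible_mat_iff_det:
  fixes B :: "'a :: field mat"
  assumes B: "B \<in> carrier_mat n n"
  shows "invertible_mat B \<longleftrightarrow> det B \<noteq> 0"
proof
  assume "invertible_mat B"
  then obtain C where C: "B * C = 1\<^sub>m n" "C * B = 1\<^sub>m (dim_row C)"
    using B unfolding invertible_mat_def inverts_mat_def by auto
  \<comment> \<open>The definition of \<open>invertible_mat\<close> leaves the size of
    \<open>C\<close> open; it is read off from the column counts of the two products.\<close>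
  then have "dim_col C = n" "dim_row C = n"
    using B by (metis index_mult_mat(3) index_one_mat(3), metis B carrier_matD(2) index_mult_mat(3) index_one_mat(3))
  then have "det B * det C = 1"
    using C B by (metis carrier_matI det_mult det_one)
  then show "det B \<noteq> 0" by auto
next
  assume "det B \<noteq> 0"
  then obtain C where "C \<in> carrier_mat n n" "C * B = 1\<^sub>m n" "B * C = 1\<^sub>m n"
    using det_non_zero_imp_unit[OF B, of "()"] unfolding Units_def ring_mat_def by auto
  then show "invertible_mat B"
    using B unfolding invertible_mat_def inverts_mat_def by auto
qed

text \<open>\<open>mat_inverse\<close> is option-valued, so \<open>the\<close> is meaningful only
  once the result \<open>None\<close> is excluded, here by the non-zero determinant.\<close>

lemma minv:
  assumes B: "B \<in> carrier_mat n n" and inv: "invertible_mat B"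
  shows "minv B \<in> carrier_mat n n" "B * minv B = 1\<^sub>m n" "minv B * B = 1\<^sub>m n"
proof -
  have "B \<in> Units (ring_mat TYPE(real) n ())"
    using det_non_zero_imp_unit[OF B, of "()"] inv invertible_mat_iff_det[OF B] by blast
  then obtain C where "mat_inverse B = Some C"
    using mat_inverse(1)[OF B, of "()"] by (cases "mat_inverse B") auto
  then show "minv B \<in> carrier_mat n n" "B * minv B = 1\<^sub>m n" "minv B * B = 1\<^sub>m n"
    using mat_inverse(2)[OF B] by auto
qed

lemma invertible_mat_minv:
  assumes B: "B \<in> carrier_mat n n" and inv: "invertible_mat B"
  shows "invertible_mat (minv B)"
  using minv[OF assms] B unfolding invertible_mat_def inverts_mat_def by auto

text \<open>The columns of \<open>P\<close> are distinct unit vectors, so the transpose is a left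
  inverse, and multiplicativity of the determinant does the rest.\<close>

lemma permutation_matD:
  assumes "is_permutation_mat n P"
  shows "P \<in> carrier_mat n n" "invertible_mat P"
proof -
  obtain p where p: "p permutes {..<n}" and P: "P = mat n n (\<lambda>(i, j). if i = p j then 1 else 0)"
    using assms unfolding is_permutation_mat_def by blast
  show PC: "P \<in> carrier_mat n n" using P by simp
  have "P\<^sup>T * P = 1\<^sub>m n"
  proof (rule eq_matI)
    fix i j assume "i < dim_row (1\<^sub>m n :: real mat)" "j < dim_col (1\<^sub>m n :: real mat)"
    then have ij: "i < n" "j < n" by auto
    have "p i \<in> {0..<n}" using permutes_in_image[OF p, of i] ij by auto
    then have "(\<Sum>k = 0..<n. (if k = p i then 1 else 0) * (if k = p j then 1 else (0::real))) =
        (if p i = p j then 1 else 0)"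
      by (simp add: if_distrib[of "\<lambda>x. x * _"] sum.delta cong: if_cong)
    also have "p i = p j \<longleftrightarrow> i = j" using permutes_inj[OF p] by (auto dest: injD)
    finally show "(P\<^sup>T * P) $$ (i, j) = 1\<^sub>m n $$ (i, j)"
      using ij by (simp add: P scalar_prod_def)
  qed (use PC in auto)
  then have "det (P\<^sup>T) * det P = 1"
    using PC by (metis det_mult det_one transpose_carrier_mat)
  then show "invertible_mat P" using invertible_mat_iff_det[OF PC] by auto
qed

text \<open>Column \<open>j\<close> of the permutation matrix is the unit vector with index
  \<open>p j\<close>, so right multiplication brings column \<open>p j\<close> of \<open>B\<close>
  to position \<open>j\<close>.\<close>

lemma mult_permutation_mat_index:
  assumes B: "B \<in> carrier_mat m n" and p: "p permutes {..<n}" and "i < m" "j < n"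
  shows "(B * mat n n (\<lambda>(i, j). if i = p j then 1 else 0)) $$ (i, j) = (B $$ (i, p j) :: real)"
proof -
  have "p j \<in> {0..<n}" using permutes_in_image[OF p, of j] assms by auto
  then show ?thesis
    using assms by (simp add: scalar_prod_def if_distrib[of "\<lambda>x. _ * x"] sum.delta cong: if_cong)
qed

section \<open>Row reduction and choice of an invertible block\<close>

lemma (in vec_space) exists_row_reduction:
  assumes E: "E \<in> carrier_mat n n"
  obtains U where "U \<in> carrier_mat n n" "det U \<noteq> 0"
    "\<And>V i j. V \<in> carrier_mat n n \<Longrightarrow> V * U = 1\<^sub>m n \<Longrightarrow> rank E \<le> i \<Longrightarrow> i < n \<Longrightarrow> j < n \<Longrightarrow>
      (V * E) $$ (i, j) = 0"
proof -
  define X where "X = set (cols E) \<union> set (unit_vecs n)"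
  have EX: "set (cols E) \<subseteq> carrier_vec n" using E cols_dim by blast
  have X: "X \<subseteq> carrier_vec n" "finite X"
    using EX unit_vecs_carrier by (auto simp: X_def)
  obtain B where Bf: "finite B" and Bm: "maximal B (\<lambda>T. T \<subseteq> set (cols E) \<and> lin_indpt T)"
    using maximal_exists_superset[of "set (cols E)" "\<lambda>T. T \<subseteq> set (cols E) \<and> lin_indpt T" "{}"]
      finite_lin_indpt2[of "{}"] by auto
  then have BE: "B \<subseteq> set (cols E)" and Bli: "lin_indpt B" by (auto simp: maximal_def)
  have r: "rank E = card B" by (rule rank_card_indpt[OF E Bm])
  \<comment> \<open>A column outside the span could be added to \<open>B\<close>, against
    maximality.\<close>
  have span_E: "v \<in> span B" if v: "v \<in> set (cols E)" for v
  proof (rule ccontr)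
    assume nv: "v \<notin> span B"
    then have "v \<notin> B" using in_own_span[of B] BE EX by auto
    moreover have "lin_indpt (B \<union> {v})"
      using lin_dep_iff_in_span[of B v] nv v BE EX Bli \<open>v \<notin> B\<close> by blast
    ultimately show False using Bm v BE unfolding maximal_def by blast
  qed
  \<comment> \<open>\<open>X\<close> contains the columns, so that \<open>B\<close> can be extended
    inside it, and the unit vectors, so that it spans everything.\<close>
  obtain B' where B'f: "finite B'" and B'm: "maximal B' (\<lambda>T. T \<subseteq> X \<and> lin_indpt T)" and BB': "B \<subseteq> B'"
    using maximal_exists_superset[of X "\<lambda>T. T \<subseteq> X \<and> lin_indpt T" B] X BE Bli
    by (auto simp: X_def)
  have B'X: "B' \<subseteq> X" and B'li: "lin_indpt B'" using B'm by (auto simp: maximal_def)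
  have sX: "span X = carrier_vec n"
    using span_is_monotone[of "set (unit_vecs n)" X] span_unit_vecs_is_carrier
      span_is_subset2[of X] X by (auto simp: X_def)
  have vV: "vs (carrier_vec n) = V" by (simp add: module_vec_def)
  have "card B' = n"
    using dim_span[OF _ X(2) B'm, unfolded sX vV dim_is_n] X by simp
  obtain bs cs where bs: "set bs = B" "distinct bs" and cs: "set cs = B' - B" "distinct cs"
    using finite_distinct_list Bf B'f by (metis finite_Diff)
  define ws where "ws = bs @ cs"
  have ws0: "set ws = B'" "distinct ws"
    using bs cs BB' by (auto simp: ws_def)
  with \<open>card B' = n\<close> have ws: "set ws = B'" "distinct ws" "length ws = n"
    using distinct_card[of ws] by auto
  have lbs: "length bs = rank E" using bs r distinct_card by metis
  define U where "U = mat_of_cols n ws"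
  have U: "U \<in> carrier_mat n n" and cU: "cols U = ws"
    using ws B'X X by (auto simp: U_def intro!: cols_mat_of_cols)
  have "rank U = n" using lin_indpt_full_rank[OF U] cU ws B'li by simp
  then have "det U \<noteq> 0" using det_rank_iff[OF U] by simp
  moreover have "(V * E) $$ (i, j) = 0"
    if V: "V \<in> carrier_mat n n" "V * U = 1\<^sub>m n" and i: "rank E \<le> i" "i < n" and j: "j < n" for V i j
  proof -
    have "col E j \<in> set (cols E)" using j E by (auto simp: cols_def)
    from span_E[OF this] obtain a where a: "col E j = lincomb a B"
      using finite_span[OF Bf] BE EX by (smt (verit) mem_Collect_eq subset_trans)
    \<comment> \<open>The coordinates of a column with respect to the larger basis: zero on the
      added vectors.\<close>
    define b where "b v = (if v \<in> B then a v else 0)" for v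
    have B'C: "B' \<subseteq> carrier_vec n" using B'X X by auto
    have "lincomb b B' = lincomb a B"
    proof (rule eq_vecI)
      fix k assume "k < dim_vec (lincomb a B)"
      then have k: "k < n" using lincomb_dim[OF Bf] BB' B'C by auto
      have "(\<Sum>v\<in>B'. b v * v $ k) = (\<Sum>v\<in>B. a v * v $ k)"
        using BB' B'f by (intro sum.mono_neutral_cong_right) (auto simp: b_def)
      then show "lincomb b B' $ k = lincomb a B $ k"
        using lincomb_index[OF k] BB' B'C by auto
    qed (use lincomb_dim[OF B'f B'C] lincomb_dim[OF Bf order.trans[OF BB' B'C]] in simp)
    then have "col E j = U *\<^sub>v vec n (\<lambda>i. b (col U i))"
      using a mat_mult_eq_lincomb[OF U, of b] cU ws by simp
    then have "col (V * E) j = V *\<^sub>v (U *\<^sub>v vec n (\<lambda>i. b (col U i)))"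
      using col_mult2[OF V(1) E j] by simp
    also have "\<dots> = vec n (\<lambda>i. b (col U i))"
      using V U by (simp flip: assoc_mult_mat_vec[of _ n n _ n])
    finally have "col (V * E) j = vec n (\<lambda>i. b (col U i))" .
    then have "(V * E) $$ (i, j) = b (col U i)"
      using i j V E by (metis carrier_matD index_col index_mult_mat(2,3) index_vec)
    \<comment> \<open>Since \<open>i\<close> is at least \<open>length bs\<close>, this column is
      one of the added vectors.\<close>
    also have "col U i = cs ! (i - rank E)"
      using i U cU ws lbs by (metis carrier_matD(2) cols_nth linorder_not_less nth_append ws_def)
    also have "b \<dots> = 0"
    proof -
      have "cs ! (i - rank E) \<in> set cs"
        using i lbs ws(3) by (auto simp: ws_def intro!: nth_mem)
      then show ?thesis using cs by (auto simp: b_def)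
    qed
    finally show ?thesis .
  qed
  ultimately show thesis using that U by blast
qed

text \<open>Induction on the number of dropped rows: expanding the determinant of the current block
  along its first row yields a non-zero cofactor, whose column is then moved out of the
  block.\<close>

lemma invertible_lower_right_block:
  fixes Z :: "'a :: field mat"
  assumes Z: "Z \<in> carrier_mat n n" and det: "det Z \<noteq> 0" and r: "r \<le> n"
  obtains p where "p permutes {..<n}" "det (mat (n - r) (n - r) (\<lambda>(i, j). Z $$ (i + r, p (j + r)))) \<noteq> 0"
  using r
proof (induction r arbitrary: thesis)
  case 0
  have "mat n n (\<lambda>(i, j). Z $$ (i, j)) = Z" using Z by auto
  then show ?case using 0(1)[OF permutes_id] det by simp
next
  case (Suc r)
  then obtain p where p: "p permutes {..<n}"
    and nz: "det (mat (n - r) (n - r) (\<lambda>(i, j). Z $$ (i + r, p (j + r)))) \<noteq> 0"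
    using Suc_leD by blast
  define C where "C = mat (n - r) (n - r) (\<lambda>(i, j). Z $$ (i + r, p (j + r)))"
  have C: "C \<in> carrier_mat (n - r) (n - r)" by (simp add: C_def)
  have "(\<Sum>j<n - r. C $$ (0, j) * cofactor C 0 j) \<noteq> 0"
    using laplace_expansion_row[OF C, of 0] nz Suc.prems by (simp add: C_def)
  then obtain q where q: "q < n - r" and "cofactor C 0 q \<noteq> 0"
    by (metis (no_types, lifting) lessThan_iff mult_zero_right sum.neutral)
  then have D: "det (mat_delete C 0 q) \<noteq> 0" by (auto simp: cofactor_def)
  \<comment> \<open>A cycle that brings column \<open>r + q\<close> to position \<open>r\<close> and
    moves the columns at \<open>r\<close> to \<open>r + q - 1\<close> one place to the right. The
    order of the others is kept, so the smaller block is exactly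
    \<open>mat_delete C 0 q\<close>.\<close>
  define s where "s i = (if i < r \<or> r + q < i then i else if i = r then r + q else i - 1)" for i
  have s: "s permutes {..<n}"
  proof (rule bij_imp_permutes)
    have "inj_on s {..<n}"
      by (auto simp: inj_on_def s_def split: if_splits)
    moreover have "s ` {..<n} \<subseteq> {..<n}" using q by (auto simp: s_def)
    ultimately show "bij_betw s {..<n} {..<n}"
      by (simp add: bij_betw_def endo_inj_surj)
  qed (use q in \<open>auto simp: s_def\<close>)
  have "mat (n - Suc r) (n - Suc r) (\<lambda>(i, j). Z $$ (i + Suc r, (p \<circ> s) (j + Suc r))) = mat_delete C 0 q"
    using q by (intro eq_matI) (auto simp: mat_delete_def C_def s_def)
  then show ?case using Suc.prems(1)[OF permutes_compose[OF s p]] D by simp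
qed

section \<open>Existence of a deflation step\<close>

text \<open>The invariant of a run: sizes and regularity. The dimension of \<open>df\<close> is
  controlled on \<open>I\<close> only, hence the care taken below with functions off
  \<open>I\<close>.\<close>

definition regular_dae :: "real set \<Rightarrow> dae \<Rightarrow> bool" where
  "regular_dae I D \<longleftrightarrow> dE D \<in> carrier_mat (dsize D) (dsize D) \<and>
     dA D \<in> carrier_mat (dsize D) (dsize D) \<and> regular_pencil (dE D) (dA D) \<and>
     (\<forall>t\<in>I. df D t \<in> carrier_vec (dsize D))"

lemma drank_le:
  assumes "regular_dae I D"
  shows "drank D \<le> dsize D"
  using assms vec_space.rank_le_nc unfolding regular_dae_def by blast

text \<open>A singular leading matrix has deficient rank; this strict inequality is what makes the
  sizes shrink and the algorithm end.\<close>

lemma drank_less: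
  assumes "regular_dae I D" "continues D"
  shows "drank D < dsize D"
  using assms vec_space.det_zero_low_rank invertible_mat_iff_det
  unfolding regular_dae_def continues_def by blast

lemma is_deflationD:
  assumes "is_deflation D d"
  defines "n \<equiv> dsize D" and "r \<equiv> drank D"
  shows "mU d \<in> carrier_mat n n" "invertible_mat (mU d)" "is_permutation_mat n (mP d)"
    "mS d \<in> carrier_mat r r" "mT d \<in> carrier_mat r (n - r)"
    "mK d \<in> carrier_mat r r" "mL d \<in> carrier_mat r (n - r)"
    "mM d \<in> carrier_mat (n - r) r" "mN d \<in> carrier_mat (n - r) (n - r)"
    "invertible_mat (mN d)"
    "minv (mU d) * dE D * mP d =
       four_block_mat (mS d) (mT d) (0\<^sub>m (n - r) r) (0\<^sub>m (n - r) (n - r))"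
    "minv (mU d) * dA D * mP d = four_block_mat (mK d) (mL d) (mM d) (mN d)"
  using assms unfolding is_deflation_def Let_def by blast+

lemma exists_deflation:
  assumes D: "regular_dae I D"
  obtains d where "is_deflation D d"
proof -
  define n where "n = dsize D"
  define r where "r = vec_space.rank n (dE D)"
  have rn: "r \<le> n" using drank_le[OF D] by (simp add: n_def r_def)
  have E: "dE D \<in> carrier_mat n n" and A: "dA D \<in> carrier_mat n n"
    using D by (auto simp: regular_dae_def n_def)
  obtain c where c: "invertible_mat (c \<cdot>\<^sub>m dE D + dA D)"
    using D by (auto simp: regular_dae_def regular_pencil_def)
  obtain U where U: "U \<in> carrier_mat n n" "det U \<noteq> 0"
    and lower: "\<And>V i j. V \<in> carrier_mat n n \<Longrightarrow> V * U = 1\<^sub>m n \<Longrightarrow> r \<le> i \<Longrightarrow> i < n \<Longrightarrow> j < n \<Longrightarrow>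
      (V * dE D) $$ (i, j) = 0"
    using vec_space.exists_row_reduction[OF E] unfolding r_def n_def by metis
  define W where "W = minv U"
  have Ui: "invertible_mat U" using U invertible_mat_iff_det by blast
  have W: "W \<in> carrier_mat n n" "W * U = 1\<^sub>m n" using minv[OF U(1) Ui] by (auto simp: W_def)
  have EW0: "(W * dE D) $$ (i, j) = 0" if "r \<le> i" "i < n" "j < n" for i j
    using lower[OF W] that by blast
  have WE: "W * dE D \<in> carrier_mat n n" and WA: "W * dA D \<in> carrier_mat n n"
    using W E A by auto
  define Z where "Z = W * (c \<cdot>\<^sub>m dE D + dA D)"
  have Z: "Z \<in> carrier_mat n n" using W E A by (auto simp: Z_def)
  have "det W \<noteq> 0" using invertible_mat_minv[OF U(1) Ui] W invertible_mat_iff_det W_def by blast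
  moreover have "det (c \<cdot>\<^sub>m dE D + dA D) \<noteq> 0"
    using c invertible_mat_iff_det[of "c \<cdot>\<^sub>m dE D + dA D" n] E A by auto
  ultimately have "det Z \<noteq> 0"
    using det_mult[OF W(1), of "c \<cdot>\<^sub>m dE D + dA D"] E A by (auto simp: Z_def)
  then obtain p where p: "p permutes {..<n}"
    and pN: "det (mat (n - r) (n - r) (\<lambda>(i, j). Z $$ (i + r, p (j + r)))) \<noteq> 0"
    using invertible_lower_right_block[OF Z _ rn] by blast
  have pn: "p j < n" if "j < n" for j
    using permutes_in_image[OF p, of j] that by auto
  \<comment> \<open>In the last \<open>n - r\<close> rows the term with \<open>c\<close> vanishes,
    which leaves the entries of \<open>W * dA D\<close>.\<close>
  have "Z = c \<cdot>\<^sub>m (W * dE D) + W * dA D"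
    unfolding Z_def using W E A
    by (subst mult_add_distrib_mat[of _ n n _ n]) (auto simp: mult_smult_distrib)
  then have ZA: "Z $$ (i, j) = (W * dA D) $$ (i, j)" if "r \<le> i" "i < n" "j < n" for i j
    using EW0[OF that] that W E A by (simp del: index_mult_mat(1))
  define P where "P = mat n n (\<lambda>(i, j). if i = p j then 1 else (0::real))"
  \<comment> \<open>All six blocks are cut out of a transformed matrix: \<open>i0\<close> and
    \<open>j0\<close> are the offsets of the block, \<open>m\<close> and \<open>k\<close> its
    size.\<close>
  define sub where "sub B i0 j0 m k = mat m k (\<lambda>(i, j). (W * B * P) $$ (i + i0, j + j0))"
    for B and i0 j0 m k :: nat
  define d where "d = \<lparr> mU = U, mP = P,
    mS = sub (dE D) 0 0 r r, mT = sub (dE D) 0 r r (n - r),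
    mK = sub (dA D) 0 0 r r, mL = sub (dA D) 0 r r (n - r),
    mM = sub (dA D) r 0 (n - r) r, mN = sub (dA D) r r (n - r) (n - r) \<rparr>"
  have WEP: "(W * dE D * P) $$ (i, j) = (W * dE D) $$ (i, p j)" if "i < n" "j < n" for i j
    unfolding P_def by (rule mult_permutation_mat_index[OF WE p that])
  have WAP: "(W * dA D * P) $$ (i, j) = (W * dA D) $$ (i, p j)" if "i < n" "j < n" for i j
    unfolding P_def by (rule mult_permutation_mat_index[OF WA p that])
  have "sub (dA D) r r (n - r) (n - r) = mat (n - r) (n - r) (\<lambda>(i, j). Z $$ (i + r, p (j + r)))"
    unfolding sub_def by (rule eq_matI) (simp_all add: WAP ZA pn del: index_mult_mat(1))
  with pN have N: "det (sub (dA D) r r (n - r) (n - r)) \<noteq> 0" by simp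
  have "is_permutation_mat n P" using p by (auto simp: is_permutation_mat_def P_def)
  moreover have "invertible_mat (sub (dA D) r r (n - r) (n - r))"
    using N by (subst invertible_mat_iff_det[of _ "n - r"]) (auto simp: sub_def)
  \<comment> \<open>\<open>P_def\<close> enters only through its dimensions, so that
    \<open>P\<close> stays folded and the entry rule \<open>WEP\<close> can fire.\<close>
  moreover have "W * dE D * P = four_block_mat (mS d) (mT d) (0\<^sub>m (n - r) r) (0\<^sub>m (n - r) (n - r))"
    using rn W E by (intro eq_matI)
      (auto simp: d_def sub_def P_def[THEN arg_cong[of _ _ dim_row]] P_def[THEN arg_cong[of _ _ dim_col]]
        WEP EW0 pn simp del: index_mult_mat(1))
  moreover have "W * dA D * P = four_block_mat (mK d) (mL d) (mM d) (mN d)"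
    using rn W A by (intro eq_matI)
      (auto simp: d_def sub_def P_def[THEN arg_cong[of _ _ dim_row]] P_def[THEN arg_cong[of _ _ dim_col]]
        simp del: index_mult_mat(1))
  ultimately have "is_deflation D d"
    using U(1) Ui unfolding is_deflation_def Let_def n_def[symmetric] r_def[symmetric]
    by (simp add: d_def sub_def W_def)
  then show thesis by (rule that)
qed

section \<open>Regularity of the deflated pencil\<close>

text \<open>Serves the lower blocks of the pencil, where the transformed \<open>dE D\<close> is
  zero.\<close>

lemma smult_zero_add_mat:
  assumes "B \<in> carrier_mat m k"
  shows "c \<cdot>\<^sub>m 0\<^sub>m m k + B = (B :: real mat)"
  using assms by auto

text \<open>Multiplying the transformed pencil on the right by the unipotent matrix with lower left block
  \<open>- N\<^sup>-\<^sup>1 M\<close> eliminates \<open>M\<close> and leaves the deflated pencil in the upper left block.\<close>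

lemma regular_pencil_deflate:
  assumes D: "regular_dae I D" and d: "is_deflation D d"
  shows "regular_pencil (dE (deflate D d)) (dA (deflate D d))"
proof -
  define n where "n = dsize D"
  define r where "r = drank D"
  have rn: "r \<le> n" using drank_le[OF D] by (simp add: n_def r_def)
  have E: "dE D \<in> carrier_mat n n" and A: "dA D \<in> carrier_mat n n"
    using D by (auto simp: regular_dae_def n_def)
  obtain c where c: "invertible_mat (c \<cdot>\<^sub>m dE D + dA D)"
    using D by (auto simp: regular_dae_def regular_pencil_def)
  note dd = is_deflationD[OF d, folded n_def r_def]
  define W where "W = minv (mU d)"
  define P where "P = mP d"
  define S T K L M N where "S = mS d" "T = mT d" "K = mK d" "L = mL d" "M = mM d" "N = mN d"
  note defs = S_T_K_L_M_N_def
  define Ni where "Ni = minv N"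
  have W: "W \<in> carrier_mat n n" "invertible_mat W"
    using minv(1)[OF dd(1,2)] invertible_mat_minv[OF dd(1,2)] by (auto simp: W_def)
  have P: "P \<in> carrier_mat n n" "invertible_mat P"
    using permutation_matD[OF dd(3)] by (auto simp: P_def)
  have C: "S \<in> carrier_mat r r" "T \<in> carrier_mat r (n - r)" "K \<in> carrier_mat r r"
    "L \<in> carrier_mat r (n - r)" "M \<in> carrier_mat (n - r) r" "N \<in> carrier_mat (n - r) (n - r)"
    using dd by (auto simp: defs)
  have Ni: "Ni \<in> carrier_mat (n - r) (n - r)" "N * Ni = 1\<^sub>m (n - r)"
    using minv[of N "n - r"] dd by (auto simp: defs Ni_def)
  have pencil: "c \<cdot>\<^sub>m dE D + dA D \<in> carrier_mat n n" using E A by auto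
  have "W * (c \<cdot>\<^sub>m dE D + dA D) * P = c \<cdot>\<^sub>m (W * dE D * P) + W * dA D * P"
    using W P E A by (subst mult_add_distrib_mat[of _ n n _ n])
      (auto simp: mult_smult_distrib add_mult_distrib_mat[of _ n n _ _ n] mult_smult_assoc_mat[of _ n n _ n])
  also have "\<dots> = four_block_mat (c \<cdot>\<^sub>m S + K) (c \<cdot>\<^sub>m T + L) M N"
    using dd(11,12) C by (simp add: W_def P_def defs[symmetric]
      smult_four_block_mat[of _ r r _ "n - r" _ "n - r"] add_four_block_mat[of _ r r _ "n - r" _ "n - r"]
      smult_zero_add_mat)
  finally have F: "W * (c \<cdot>\<^sub>m dE D + dA D) * P = four_block_mat (c \<cdot>\<^sub>m S + K) (c \<cdot>\<^sub>m T + L) M N" .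
  define X where "X = Ni * M"
  have X: "X \<in> carrier_mat (n - r) r" using Ni C by (auto simp: X_def)
  define Q where "Q = four_block_mat (1\<^sub>m r) (0\<^sub>m r (n - r)) (- X) (1\<^sub>m (n - r))"
  have "N * X = M"
    using assoc_mult_mat[of N "n - r" "n - r" Ni "n - r" M r] C Ni by (simp add: X_def)
  then have "M * 1\<^sub>m r + N * (- X) = 0\<^sub>m (n - r) r"
    using C X by (auto simp: mult_minus_distrib_mat[of _ _ "n - r" _ r] intro!: eq_matI)
  moreover have "(c \<cdot>\<^sub>m S + K) * 1\<^sub>m r + (c \<cdot>\<^sub>m T + L) * (- X) = c \<cdot>\<^sub>m (S - T * X) + (K - L * X)"
  proof -
    have "(c \<cdot>\<^sub>m T + L) * (- X) = - (c \<cdot>\<^sub>m (T * X) + L * X)"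
      using C X by (simp add: add_mult_distrib_mat[of _ r "n - r" _ _ r] mult_smult_assoc_mat[of _ r "n - r" _ r])
    then show ?thesis using C X by (auto intro!: eq_matI simp: algebra_simps simp del: index_mult_mat(1))
  qed
  ultimately have FQ: "four_block_mat (c \<cdot>\<^sub>m S + K) (c \<cdot>\<^sub>m T + L) M N * Q =
      four_block_mat (c \<cdot>\<^sub>m (S - T * X) + (K - L * X)) (c \<cdot>\<^sub>m T + L) (0\<^sub>m (n - r) r) N"
    unfolding Q_def using C X
    by (subst mult_four_block_mat[of _ r r _ "n - r" _ "n - r" _ _ r _ "n - r"]) auto
  have "det Q = 1"
    unfolding Q_def using X by (subst det_four_block_mat_upper_right_zero[of _ r _ "n - r"]) auto
  have Q: "Q \<in> carrier_mat n n"
    using four_block_carrier_mat[of "1\<^sub>m r" r r "1\<^sub>m (n - r)" "n - r" "n - r"] rn by (simp add: Q_def)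
  \<comment> \<open>The determinant of the transformed pencil is that of the Schur complement times
    \<open>det N\<close>, so a non-zero value forces the first factor to be non-zero.\<close>
  have "det (c \<cdot>\<^sub>m (S - T * X) + (K - L * X)) * det N =
      det (four_block_mat (c \<cdot>\<^sub>m (S - T * X) + (K - L * X)) (c \<cdot>\<^sub>m T + L) (0\<^sub>m (n - r) r) N)"
    using C X by (intro det_four_block_mat_lower_left_zero[symmetric]) auto
  also have "\<dots> = det (W * (c \<cdot>\<^sub>m dE D + dA D) * P * Q)"
    unfolding F FQ ..
  also have "\<dots> = det (W * (c \<cdot>\<^sub>m dE D + dA D) * P)"
    using W P pencil Q \<open>det Q = 1\<close> by (subst det_mult[of _ n]) auto
  also have "\<dots> \<noteq> 0"
    using W P pencil c invertible_mat_iff_det by (auto simp: det_mult[of _ n])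
  finally have "det (c \<cdot>\<^sub>m (S - T * X) + (K - L * X)) \<noteq> 0" by auto
  moreover have "c \<cdot>\<^sub>m (S - T * X) + (K - L * X) \<in> carrier_mat r r"
    using C X by (intro add_carrier_mat minus_carrier_mat mult_carrier_mat)
  ultimately have "invertible_mat (c \<cdot>\<^sub>m (S - T * X) + (K - L * X))"
    using invertible_mat_iff_det by blast
  \<comment> \<open>Reassociates to the form in which \<open>deflate\<close> writes the
    products.\<close>
  moreover have "T * X = T * Ni * M" "L * X = L * Ni * M"
    using C Ni by (auto simp: X_def)
  ultimately show ?thesis
    unfolding regular_pencil_def deflate_def by (auto simp: defs Ni_def)
qed

lemma regular_dae_deflate:
  assumes D: "regular_dae I D" and d: "is_deflation D d"
  shows "regular_dae I (deflate D d)"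
proof -
  note dd = is_deflationD[OF d]
  have "minv (mN d) \<in> carrier_mat (dsize D - drank D) (dsize D - drank D)"
    using minv(1) dd by blast
  then show ?thesis
    using dd regular_pencil_deflate[OF assms] unfolding regular_dae_def
    by (auto simp: deflate_def f_upper_def intro!: carrier_vecI carrier_matI)
qed

section \<open>Runs of the algorithm and termination\<close>

text \<open>Lets a run be prolonged by changing \<open>ds\<close> at later indices without affecting
  the systems already reached.\<close>

lemma dae_seq_cong:
  assumes "\<And>j. j < m \<Longrightarrow> ds j = ds' j"
  shows "dae_seq D ds m = dae_seq D ds' m"
  using assms by (induction m) auto

lemma deflation_run_cong:
  assumes "\<And>j. j < m \<Longrightarrow> ds j = ds' j"
  shows "deflation_run D ds m \<longleftrightarrow> deflation_run D ds' m"
  using assms dae_seq_cong[of _ ds ds' D] unfolding deflation_run_def by auto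

lemma regular_dae_seq:
  assumes "regular_dae I D" "deflation_run D ds m" "j \<le> m"
  shows "regular_dae I (dae_seq D ds j)"
  using \<open>j \<le> m\<close>
proof (induction j)
  case (Suc j)
  then show ?case using assms regular_dae_deflate by (auto simp: deflation_run_def)
qed (use assms in simp)

text \<open>Each step lowers the size by at least one, so the initial size bounds the number of
  steps.\<close>

lemma deflation_run_length:
  assumes "regular_dae I D" "deflation_run D ds m"
  shows "dsize (dae_seq D ds m) + m \<le> dsize D"
proof -
  have "dsize (dae_seq D ds j) + j \<le> dsize D" if "j \<le> m" for j
    using that
  proof (induction j)
    case (Suc j)
    then have "drank (dae_seq D ds j) < dsize (dae_seq D ds j)"
      using assms drank_less[of I "dae_seq D ds j"] regular_dae_seq[OF assms, of j]
      by (auto simp: deflation_run_def)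
    with Suc show ?case by (simp add: deflate_def)
  qed simp
  then show ?thesis by simp
qed

text \<open>While the algorithm continues, regularity provides one more step; the length bound
  limits how often this can happen.\<close>

lemma deflation_run_extends:
  assumes D: "regular_dae I D" and run: "deflation_run D ds m"
  shows "\<exists>ds' k. (\<forall>j<m. ds' j = ds j) \<and> m \<le> k \<and> k \<le> dsize D \<and> complete_deflation_run D ds' k"
  using run
proof (induction "dsize D - m" arbitrary: m ds rule: less_induct)
  case less
  have len: "dsize (dae_seq D ds m) + m \<le> dsize D"
    by (rule deflation_run_length[OF D less.prems])
  show ?case
  proof (cases "continues (dae_seq D ds m)")
    case False
    then show ?thesis
      using less.prems len by (intro exI[of _ ds] exI[of _ m]) (auto simp: complete_deflation_run_def)
  next
    case True
    have R: "regular_dae I (dae_seq D ds m)" using regular_dae_seq[OF D less.prems] by simp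
    obtain d where d: "is_deflation (dae_seq D ds m) d" using exists_deflation[OF R] .
    define ds1 where "ds1 = ds(m := d)"
    have "dae_seq D ds1 m = dae_seq D ds m"
      by (rule dae_seq_cong) (simp add: ds1_def)
    moreover have "deflation_run D ds1 m \<longleftrightarrow> deflation_run D ds m"
      by (rule deflation_run_cong) (simp add: ds1_def)
    ultimately have run1: "deflation_run D ds1 (Suc m)"
      using less.prems True d by (auto simp: deflation_run_def less_Suc_eq ds1_def)
    \<comment> \<open>The longer run shows \<open>Suc m \<le> dsize D\<close>, so the truncated
      subtraction really decreases.\<close>
    have "dsize D - Suc m < dsize D - m"
      using deflation_run_length[OF D run1] by simp
    from less.hyps[OF this run1] show ?thesis
      by (metis Suc_leD ds1_def fun_upd_other less_Suc_eq nat_neq_iff)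
  qed
qed

section \<open>Componentwise derivatives of vector functions\<close>

text \<open>\<open>vderiv\<close> is built on the total function \<open>deriv\<close> and does not
  assert differentiability; this relation does, and it fixes the dimensions as well.\<close>

definition has_vderiv :: "nat \<Rightarrow> (real \<Rightarrow> real vec) \<Rightarrow> real vec \<Rightarrow> real \<Rightarrow> bool" where
  "has_vderiv n F F' t \<longleftrightarrow> F t \<in> carrier_vec n \<and> F' \<in> carrier_vec n \<and>
     (\<forall>i<n. ((\<lambda>s. F s $ i) has_real_derivative F' $ i) (at t))"

lemma has_vderiv_vderiv:
  assumes "F t \<in> carrier_vec n" "\<forall>i<n. (\<lambda>s. F s $ i) differentiable at t"
  shows "has_vderiv n F (vderiv F t) t"
  using assms by (auto simp: has_vderiv_def vderiv_def DERIV_deriv_iff_real_differentiable)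

lemma has_vderiv_imp_vderiv:
  assumes "has_vderiv n F F' t"
  shows "vderiv F t = F'"
  using assms by (intro eq_vecI) (auto simp: has_vderiv_def vderiv_def intro!: DERIV_imp_deriv)

lemma has_vderiv_differentiable:
  assumes "has_vderiv n F F' t" "i < n"
  shows "(\<lambda>s. F s $ i) differentiable at t"
  using assms by (auto simp: has_vderiv_def real_differentiable_def)

text \<open>Off \<open>I\<close> the vectors may have other dimensions, so identities between vector
  functions are available on \<open>I\<close> only; openness makes that enough.\<close>

lemma has_vderiv_transform:
  assumes I: "open I" "t \<in> I" and F: "has_vderiv n F F' t" and FG: "\<And>s. s \<in> I \<Longrightarrow> F s = G s"
  shows "has_vderiv n G F' t"
  unfolding has_vderiv_def
proof (intro conjI allI impI)
  fix i assume "i < n"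
  then have "((\<lambda>s. F s $ i) has_real_derivative F' $ i) (at t)"
    using F by (simp add: has_vderiv_def)
  then show "((\<lambda>s. G s $ i) has_real_derivative F' $ i) (at t)"
    by (rule has_field_derivative_transform_within_open[OF _ I]) (simp add: FG)
qed (use F FG[OF I(2)] in \<open>auto simp: has_vderiv_def\<close>)

lemma has_vderiv_mult_mat:
  assumes B: "B \<in> carrier_mat m k" and I: "open I" "t \<in> I"
    and F: "has_vderiv k F F' t" and car: "\<And>s. s \<in> I \<Longrightarrow> F s \<in> carrier_vec k"
  shows "has_vderiv m (\<lambda>s. B *\<^sub>v F s) (B *\<^sub>v F') t"
  unfolding has_vderiv_def
proof (intro conjI allI impI)
  have F': "F' \<in> carrier_vec k" using F by (simp add: has_vderiv_def)
  fix i assume i: "i < m"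
  \<comment> \<open>The summation range of the scalar product is the dimension of \<open>w\<close>,
    hence the carrier condition.\<close>
  have entry: "(B *\<^sub>v w) $ i = (\<Sum>j<k. B $$ (i, j) * w $ j)" if "w \<in> carrier_vec k" for w
    using that i B by (simp add: scalar_prod_def atLeast0LessThan)
  have "((\<lambda>s. \<Sum>j<k. B $$ (i, j) * F s $ j) has_real_derivative (\<Sum>j<k. B $$ (i, j) * F' $ j)) (at t)"
    using F by (intro DERIV_sum DERIV_cmult) (auto simp: has_vderiv_def)
  then show "((\<lambda>s. (B *\<^sub>v F s) $ i) has_real_derivative (B *\<^sub>v F') $ i) (at t)"
    unfolding entry[OF F'] by (rule has_field_derivative_transform_within_open[OF _ I]) (simp only: entry[OF car])
qed (use B in \<open>auto intro: carrier_vecI\<close>)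

lemma has_vderiv_vec_first:
  assumes "has_vderiv n F F' t" "r \<le> n"
  shows "has_vderiv r (\<lambda>s. vec_first (F s) r) (vec_first F' r) t"
  using assms by (auto simp: has_vderiv_def vec_first_def)

text \<open>\<open>vec_last\<close> counts from the end, so its indices depend on the dimension of
  \<open>F s\<close>, which is known on \<open>I\<close> only.\<close>

lemma has_vderiv_vec_last:
  assumes I: "open I" "t \<in> I" and F: "has_vderiv n F F' t" and "m \<le> n"
    and car: "\<And>s. s \<in> I \<Longrightarrow> F s \<in> carrier_vec n"
  shows "has_vderiv m (\<lambda>s. vec_last (F s) m) (vec_last F' m) t"
proof (rule has_vderiv_transform[OF I])
  show "has_vderiv m (\<lambda>s. vec m (\<lambda>i. F s $ (n - m + i))) (vec_last F' m) t"
    using assms by (auto simp: has_vderiv_def vec_last_def)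
  show "vec m (\<lambda>i. F s $ (n - m + i)) = vec_last (F s) m" if "s \<in> I" for s
    using car[OF that] by (auto simp: vec_last_def)
qed

text \<open>Shaped for differentiating the constraint in the form
  \<open>h = - (M u + N v)\<close>.\<close>

lemma has_vderiv_uminus_add:
  assumes I: "open I" "t \<in> I" and F: "has_vderiv n F F' t" and G: "has_vderiv n G G' t"
    and car: "\<And>s. s \<in> I \<Longrightarrow> F s \<in> carrier_vec n" "\<And>s. s \<in> I \<Longrightarrow> G s \<in> carrier_vec n"
  shows "has_vderiv n (\<lambda>s. - (F s + G s)) (- (F' + G')) t"
proof (rule has_vderiv_transform[OF I])
  have "F' \<in> carrier_vec n" "G' \<in> carrier_vec n" using F G by (auto simp: has_vderiv_def)
  then show "has_vderiv n (\<lambda>s. vec n (\<lambda>i. - (F s $ i + G s $ i))) (- (F' + G')) t"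
    using F G by (auto simp: has_vderiv_def intro!: derivative_eq_intros)
  show "vec n (\<lambda>i. - (F s $ i + G s $ i)) = - (F s + G s)" if "s \<in> I" for s
    using car(1)[OF that] car(2)[OF that] by (auto intro!: eq_vecI)
qed

section \<open>Solutions of the deflated system\<close>

lemma mult_mat_uminus_vec:
  fixes B :: "'a :: ring mat"
  assumes "B \<in> carrier_mat m k" "w \<in> carrier_vec k"
  shows "B *\<^sub>v (- w) = - (B *\<^sub>v w)"
  using assms by (intro eq_vecI) auto

lemma zero_mat_mult_vec:
  assumes "w \<in> carrier_vec k"
  shows "0\<^sub>m m k *\<^sub>v w = (0\<^sub>v m :: 'a :: semiring_0 vec)"
  using assms by (intro eq_vecI) (auto simp: scalar_prod_def)

text \<open>For the permuted unknown, multiplication by the inverse of \<open>mU d\<close> splits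
  the system into a differential and an algebraic block row. The algebraic row solved for
  \<open>v\<close> is the second claim; its derivative expresses the derivative of \<open>h\<close>
  through those of \<open>u\<close> and \<open>v\<close>, which removes
  \<open>T *\<^sub>v v' t\<close> from the differential row.\<close>

lemma deflate_solution:
  assumes D: "regular_dae I D" and d: "is_deflation D d" and I: "open I" and x: "solves_on I D x"
  shows "solves_on I (deflate D d) (x_upper D d x)"
    and "\<And>t. t \<in> I \<Longrightarrow> x_lower D d x t =
      (- (minv (mN d) * mM d)) *\<^sub>v x_upper D d x t - minv (mN d) *\<^sub>v f_lower D d t"
proof -
  define n where "n = dsize D"
  define r where "r = drank D"
  have rn: "r \<le> n" using drank_le[OF D] by (simp add: n_def r_def)
  have E: "dE D \<in> carrier_mat n n" and A: "dA D \<in> carrier_mat n n"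
    and f: "\<And>t. t \<in> I \<Longrightarrow> df D t \<in> carrier_vec n"
    using D by (auto simp: regular_dae_def n_def)
  note dd = is_deflationD[OF d, folded n_def r_def]
  define W where "W = minv (mU d)"
  define P where "P = mP d"
  define Pi where "Pi = minv P"
  define S T K L M N where "S = mS d" "T = mT d" "K = mK d" "L = mL d" "M = mM d" "N = mN d"
  note defs = S_T_K_L_M_N_def
  define Ni where "Ni = minv N"
  have W: "W \<in> carrier_mat n n" using minv(1)[OF dd(1,2)] by (auto simp: W_def)
  have P: "P \<in> carrier_mat n n" "Pi \<in> carrier_mat n n" "P * Pi = 1\<^sub>m n"
    using permutation_matD[OF dd(3)] minv by (auto simp: P_def Pi_def)
  have C: "S \<in> carrier_mat r r" "T \<in> carrier_mat r (n - r)" "K \<in> carrier_mat r r"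
    "L \<in> carrier_mat r (n - r)" "M \<in> carrier_mat (n - r) r" "N \<in> carrier_mat (n - r) (n - r)"
    using dd by (auto simp: defs)
  have Ni: "Ni \<in> carrier_mat (n - r) (n - r)" "Ni * N = 1\<^sub>m (n - r)"
    using minv[of N "n - r"] dd by (auto simp: defs Ni_def)
  \<comment> \<open>The permuted unknown; \<open>y'\<close> is the permuted derivative of
    \<open>x\<close> and is shown below to be the derivative of \<open>y\<close>.\<close>
  define y where "y t = Pi *\<^sub>v x t" for t
  define y' where "y' t = Pi *\<^sub>v vderiv x t" for t
  define u v where uv_def: "u = x_upper D d x" "v = x_lower D d x"
  define g h where gh_def: "g = f_upper D d" "h = f_lower D d"
  define u' v' where u'v'_def: "u' t = vec_first (y' t) r" "v' t = vec_last (y' t) (n - r)" for t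
  have uv: "u t = vec_first (y t) r" "v t = vec_last (y t) (n - r)" for t
    by (simp_all add: uv_def x_upper_def x_lower_def y_def Pi_def P_def n_def r_def)
  have gh: "g t = vec_first (W *\<^sub>v df D t) r" "h t = vec_last (W *\<^sub>v df D t) (n - r)" for t
    by (simp_all add: gh_def f_upper_def f_lower_def W_def n_def r_def)
  have xc: "x t \<in> carrier_vec n" and eq: "dE D *\<^sub>v vderiv x t = dA D *\<^sub>v x t + df D t"
    and hx: "has_vderiv n x (vderiv x t) t" if "t \<in> I" for t
    using x that by (auto simp: solves_on_def n_def intro!: has_vderiv_vderiv)
  have x'c: "vderiv x t \<in> carrier_vec n" if "t \<in> I" for t
    using hx[OF that] by (simp add: has_vderiv_def)
  have car: "u t \<in> carrier_vec r" "v t \<in> carrier_vec (n - r)" "u' t \<in> carrier_vec r"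
    "v' t \<in> carrier_vec (n - r)" "g t \<in> carrier_vec r" "h t \<in> carrier_vec (n - r)" for t
    by (simp_all add: uv gh u'v'_def)
  have yc: "y t \<in> carrier_vec n" "y' t \<in> carrier_vec n" for t
    using P by (auto simp: y_def y'_def intro!: carrier_vecI)
  have hy: "has_vderiv n y (y' t) t" if "t \<in> I" for t
    unfolding y_def y'_def by (rule has_vderiv_mult_mat[OF P(2) I that hx[OF that] xc])
  have hu: "has_vderiv r u (u' t) t" if "t \<in> I" for t
    using has_vderiv_vec_first[OF hy[OF that] rn] by (simp flip: uv u'v'_def)
  have hv: "has_vderiv (n - r) v (v' t) t" if "t \<in> I" for t
    using has_vderiv_vec_last[OF I that hy[OF that] _ yc(1), of "n - r"] by (simp flip: uv u'v'_def)
  have blocks: "S *\<^sub>v u' t + T *\<^sub>v v' t = K *\<^sub>v u t + L *\<^sub>v v t + g t"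
    "M *\<^sub>v u t + N *\<^sub>v v t + h t = 0\<^sub>v (n - r)" if t: "t \<in> I" for t
  proof -
    have split: "w = vec_first w r @\<^sub>v vec_last w (n - r)" if "w \<in> carrier_vec n" for w :: "real vec"
      using that rn by simp
    have "P *\<^sub>v y t = x t" "P *\<^sub>v y' t = vderiv x t"
      using P xc[OF t] x'c[OF t] by (simp_all add: y_def y'_def flip: assoc_mult_mat_vec[of _ n n _ n])
    then have "(W * dE D * P) *\<^sub>v y' t = W *\<^sub>v (dE D *\<^sub>v vderiv x t)"
      "(W * dA D * P) *\<^sub>v y t = W *\<^sub>v (dA D *\<^sub>v x t)"
      using W E A P yc by (simp_all add: assoc_mult_mat_vec[of _ n n _ n])
    then have "(W * dE D * P) *\<^sub>v y' t = (W * dA D * P) *\<^sub>v y t + W *\<^sub>v df D t"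
      using eq[OF t] W A xc[OF t] f[OF t] by (simp add: mult_add_distrib_mat_vec[of _ n n])
    moreover have "(W * dE D * P) *\<^sub>v y' t =
        (S *\<^sub>v u' t + T *\<^sub>v v' t) @\<^sub>v (0\<^sub>m (n - r) r *\<^sub>v u' t + 0\<^sub>m (n - r) (n - r) *\<^sub>v v' t)"
      using dd(11) C car split[OF yc(2)]
      by (simp add: W_def P_def defs[symmetric] u'v'_def four_block_mat_mult_vec[of _ r r _ "n - r" _ "n - r"] flip: u'v'_def)
    moreover have "(W * dA D * P) *\<^sub>v y t =
        (K *\<^sub>v u t + L *\<^sub>v v t) @\<^sub>v (M *\<^sub>v u t + N *\<^sub>v v t)"
      using dd(12) C car split[OF yc(1)]
      by (simp add: W_def P_def defs[symmetric] uv four_block_mat_mult_vec[of _ r r _ "n - r" _ "n - r"] flip: uv)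
    moreover have "W *\<^sub>v df D t = g t @\<^sub>v h t"
      using split[of "W *\<^sub>v df D t"] W f[OF t] by (simp add: gh)
    \<comment> \<open>The zero blocks of the transformed \<open>dE D\<close> make the second block
      row purely algebraic.\<close>
    ultimately have "(S *\<^sub>v u' t + T *\<^sub>v v' t) @\<^sub>v (0\<^sub>m (n - r) r *\<^sub>v u' t + 0\<^sub>m (n - r) (n - r) *\<^sub>v v' t) =
        (K *\<^sub>v u t + L *\<^sub>v v t + g t) @\<^sub>v (M *\<^sub>v u t + N *\<^sub>v v t + h t)"
      using C car by (simp add: append_vec_add[of _ r _ _ "n - r"])
    moreover have "S *\<^sub>v u' t + T *\<^sub>v v' t \<in> carrier_vec r" "K *\<^sub>v u t + L *\<^sub>v v t + g t \<in> carrier_vec r"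
      using C car by (auto intro!: carrier_vecI)
    ultimately have "S *\<^sub>v u' t + T *\<^sub>v v' t = K *\<^sub>v u t + L *\<^sub>v v t + g t"
      "0\<^sub>m (n - r) r *\<^sub>v u' t + 0\<^sub>m (n - r) (n - r) *\<^sub>v v' t = M *\<^sub>v u t + N *\<^sub>v v t + h t"
      using append_vec_eq by blast+
    then show "S *\<^sub>v u' t + T *\<^sub>v v' t = K *\<^sub>v u t + L *\<^sub>v v t + g t"
      "M *\<^sub>v u t + N *\<^sub>v v t + h t = 0\<^sub>v (n - r)"
      using car by (simp_all add: zero_mat_mult_vec)
  qed
  have NiNv: "Ni *\<^sub>v (N *\<^sub>v w) = w" if "w \<in> carrier_vec (n - r)" for w
    using Ni C that by (simp flip: assoc_mult_mat_vec[of _ "n - r" "n - r" _ "n - r"])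
  have hM: "h t = - (M *\<^sub>v u t + N *\<^sub>v v t)" if "t \<in> I" for t
  proof (rule eq_vecI)
    fix i assume "i < dim_vec (- (M *\<^sub>v u t + N *\<^sub>v v t))"
    then show "h t $ i = (- (M *\<^sub>v u t + N *\<^sub>v v t)) $ i"
      using arg_cong[OF blocks(2)[OF that], of "\<lambda>w. w $ i"] C car[of t] by simp
  qed (use C car[of t] in simp)
  have Nih: "Ni *\<^sub>v (- (M *\<^sub>v a + N *\<^sub>v b)) = - (Ni *\<^sub>v (M *\<^sub>v a) + b)"
    if "a \<in> carrier_vec r" "b \<in> carrier_vec (n - r)" for a b
    using Ni C that NiNv[OF that(2)]
    by (simp add: mult_add_distrib_mat_vec[of _ "n - r" "n - r"] mult_mat_uminus_vec[of _ _ "n - r"])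
  \<comment> \<open>The identity for \<open>h\<close> holds throughout the open set \<open>I\<close>
    and may therefore be differentiated there.\<close>
  have hh: "vderiv h t = - (M *\<^sub>v u' t + N *\<^sub>v v' t)" if t: "t \<in> I" for t
  proof (rule has_vderiv_imp_vderiv[OF has_vderiv_transform[OF I t]])
    show "has_vderiv (n - r) (\<lambda>s. - (M *\<^sub>v u s + N *\<^sub>v v s)) (- (M *\<^sub>v u' t + N *\<^sub>v v' t)) t"
      using C car hu[OF t] hv[OF t]
      by (intro has_vderiv_uminus_add[OF I t] has_vderiv_mult_mat[OF _ I t]) (auto intro!: carrier_vecI)
  qed (use hM in simp)
  show "x_lower D d x t = (- (minv (mN d) * mM d)) *\<^sub>v x_upper D d x t - minv (mN d) *\<^sub>v f_lower D d t"
    if t: "t \<in> I" for t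
  proof -
    have "v t = (- (Ni * M)) *\<^sub>v u t - Ni *\<^sub>v h t"
      using Ni C car[of t] by (auto simp: hM[OF t] Nih assoc_mult_mat_vec[of _ "n - r" "n - r"]
        intro!: eq_vecI simp del: index_mult_mat_vec)
    then show ?thesis by (simp add: uv_def gh_def Ni_def defs)
  qed
  show "solves_on I (deflate D d) (x_upper D d x)"
    unfolding solves_on_def
  proof (intro ballI conjI allI impI)
    fix t assume t: "t \<in> I"
    show "x_upper D d x t \<in> carrier_vec (dsize (deflate D d))"
      using car(1)[of t] by (simp add: uv_def deflate_def r_def)
    show "(\<lambda>s. x_upper D d x s $ i) differentiable at t" if "i < dsize (deflate D d)" for i
      using has_vderiv_differentiable[OF hu[OF t]] that by (simp add: uv_def deflate_def r_def)
    define a where "a = M *\<^sub>v u t"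
    define a' where "a' = M *\<^sub>v u' t"
    have aa': "a \<in> carrier_vec (n - r)" "a' \<in> carrier_vec (n - r)"
      using C car by (auto simp: a_def a'_def intro!: carrier_vecI)
    have "(B * Ni * M) *\<^sub>v w = B *\<^sub>v (Ni *\<^sub>v (M *\<^sub>v w))"
      if B: "B \<in> carrier_mat r (n - r)" and w: "w \<in> carrier_vec r" for B w
      using assoc_mult_mat_vec[OF mult_carrier_mat[OF B Ni(1)] C(5) w]
        assoc_mult_mat_vec[OF B Ni(1) mult_mat_vec_carrier[OF C(5) w]] by simp
    moreover have "T * Ni * M \<in> carrier_mat r r" "L * Ni * M \<in> carrier_mat r r"
      using mult_carrier_mat[OF mult_carrier_mat[OF C(2) Ni(1)] C(5)]
        mult_carrier_mat[OF mult_carrier_mat[OF C(4) Ni(1)] C(5)] by blast+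
    ultimately have "(S - T * Ni * M) *\<^sub>v u' t = S *\<^sub>v u' t - T *\<^sub>v (Ni *\<^sub>v a')"
      "(K - L * Ni * M) *\<^sub>v u t = K *\<^sub>v u t - L *\<^sub>v (Ni *\<^sub>v a)"
      using C car minus_mult_distrib_mat_vec[OF C(1), of "T * Ni * M" "u' t"]
        minus_mult_distrib_mat_vec[OF C(3), of "L * Ni * M" "u t"]
      by (simp_all only: a_def a'_def)
    moreover have "(T * Ni) *\<^sub>v vderiv h t = - (T *\<^sub>v (Ni *\<^sub>v a') + T *\<^sub>v v' t)"
      "(L * Ni) *\<^sub>v h t = - (L *\<^sub>v (Ni *\<^sub>v a) + L *\<^sub>v v t)"
      using C Ni car aa' unfolding hh[OF t] hM[OF t]
      by (simp_all add: assoc_mult_mat_vec[of _ _ "n - r" _ "n - r"] NiNv mult_mat_uminus_vec[of _ _ "n - r"]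
        mult_add_distrib_mat_vec[of _ _ "n - r"] flip: a_def a'_def)
    \<comment> \<open>Here \<open>s\<close>, \<open>b\<close>, \<open>k\<close>, \<open>l\<close>
      are the terms of the differential row, in the order \<open>S u'\<close>, \<open>T v'\<close>,
      \<open>K u\<close>, \<open>L v\<close>, while \<open>p\<close> and \<open>q\<close> are the
      corrections \<open>T Ni M u'\<close> and \<open>L Ni M u\<close>.\<close>
    moreover have "s - p = k - q + (- (p + b) - - (q + l) + g t)"
      if "s + b = k + l + g t" "s \<in> carrier_vec r" "p \<in> carrier_vec r" "k \<in> carrier_vec r"
        "q \<in> carrier_vec r" "b \<in> carrier_vec r" "l \<in> carrier_vec r" for s p k q b l
    proof (rule eq_vecI)
      fix i assume "i < dim_vec (k - q + (- (p + b) - - (q + l) + g t))"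
      then show "(s - p) $ i = (k - q + (- (p + b) - - (q + l) + g t)) $ i"
        using arg_cong[OF that(1), of "\<lambda>w. w $ i"] that(2-) car(5)[of t] by simp
    qed (use that(2-) car(5)[of t] in simp)
    note this[OF blocks(1)[OF t]]
    ultimately have "(S - T * Ni * M) *\<^sub>v u' t =
        (K - L * Ni * M) *\<^sub>v u t + ((T * Ni) *\<^sub>v vderiv h t - (L * Ni) *\<^sub>v h t + g t)"
      using C Ni car aa' by simp
    then show "dE (deflate D d) *\<^sub>v vderiv (x_upper D d x) t =
        dA (deflate D d) *\<^sub>v x_upper D d x t + df (deflate D d) t"
      using has_vderiv_imp_vderiv[OF hu[OF t]]
      by (simp add: deflate_def uv_def gh_def Ni_def defs)
  qed
qed

lemma deflation_run_solution:
  assumes D: "regular_dae I D" and run: "deflation_run D ds k" and I: "open I" and x: "solves_on I D x"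
    and "j \<le> k"
  shows "solves_on I (dae_seq D ds j) (x_seq D ds x j)"
  using \<open>j \<le> k\<close>
proof (induction j)
  case (Suc j)
  then show ?case
    using deflate_solution(1)[OF regular_dae_seq[OF D run] _ I] run by (simp add: deflation_run_def)
qed (use x in simp)

text \<open>The choices in a step are not unique, so the second part ranges over all complete runs.
  The first part shows that it is not vacuous: every partial run, in particular the empty one,
  extends to a complete run of at most \<open>n\<close> steps.\<close>

theorem theorem4:
  fixes n :: nat and E A :: "real mat" and f :: "real \<Rightarrow> real vec" and I :: "real set"
  defines "D \<equiv> \<lparr> dsize = n, dE = E, dA = A, df = f \<rparr>"
  assumes E: "E \<in> carrier_mat n n" and A: "A \<in> carrier_mat n n"
    and regular: "regular_pencil E A"
    and I: "open I" "is_interval I"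
    and f: "\<And>t. t \<in> I \<Longrightarrow> f t \<in> carrier_vec n"
  shows
    "(\<forall>ds m. deflation_run D ds m \<longrightarrow>
        (\<exists>ds' k. (\<forall>j<m. ds' j = ds j) \<and> m \<le> k \<and> k \<le> n \<and> complete_deflation_run D ds' k)) \<and>
     (\<forall>ds k. complete_deflation_run D ds k \<longrightarrow>
        (let Dk = dae_seq D ds k in
           invertible_mat (dE Dk) \<or> dE Dk = 0\<^sub>m (dsize Dk) (dsize Dk)) \<and>
        (times_differentiable_on k n I f \<longrightarrow>
          (\<forall>x. solves_on I D x \<longrightarrow>
             solves_on I (dae_seq D ds k) (x_seq D ds x k) \<and>
             (\<forall>j<k. \<forall>t\<in>I.
                x_lower (dae_seq D ds j) (ds j) (x_seq D ds x j) t =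
                  (- (minv (mN (ds j)) * mM (ds j))) *\<^sub>v
                      x_upper (dae_seq D ds j) (ds j) (x_seq D ds x j) t
                  - minv (mN (ds j)) *\<^sub>v f_lower (dae_seq D ds j) (ds j) t))))"
proof -
  have D: "regular_dae I D"
    using E A regular f by (simp add: regular_dae_def D_def)
  have n: "dsize D = n" by (simp add: D_def)
  have lower: "x_lower (dae_seq D ds j) (ds j) (x_seq D ds x j) t =
      (- (minv (mN (ds j)) * mM (ds j))) *\<^sub>v x_upper (dae_seq D ds j) (ds j) (x_seq D ds x j) t
        - minv (mN (ds j)) *\<^sub>v f_lower (dae_seq D ds j) (ds j) t"
    if run: "deflation_run D ds k" and x: "solves_on I D x" and "j < k" "t \<in> I" for ds k x j t
  proof -
    have "regular_dae I (dae_seq D ds j)" "is_deflation (dae_seq D ds j) (ds j)"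
      "solves_on I (dae_seq D ds j) (x_seq D ds x j)"
      using regular_dae_seq[OF D run] deflation_run_solution[OF D run I(1) x] run \<open>j < k\<close>
      by (auto simp: deflation_run_def)
    then show "x_lower (dae_seq D ds j) (ds j) (x_seq D ds x j) t =
      (- (minv (mN (ds j)) * mM (ds j))) *\<^sub>v x_upper (dae_seq D ds j) (ds j) (x_seq D ds x j) t
        - minv (mN (ds j)) *\<^sub>v f_lower (dae_seq D ds j) (ds j) t"
      using deflate_solution(2)[OF _ _ I(1)] \<open>t \<in> I\<close> by blast
  qed
  \<comment> \<open>The alternative for the final leading matrix is the negation of
    \<open>continues\<close>.\<close>
  show ?thesis
    using deflation_run_extends[OF D] deflation_run_solution[OF D _ I(1) _ order.refl] lower
    unfolding complete_deflation_run_def continues_def Let_def n by blast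
qed

end
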